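(* In the setting of the context, assume: (1) there exist functions $N_V,N_U\in C(I,\mathbb{R}_+)$ and a constant $L_G>0$ such that for all $t,s\in I$, $\vartheta_1,\vartheta_2\in\mathscr{C}$ and $x_1,x_2\in X$, $$\|V(t,\vartheta_1,x_1)-V(t,\vartheta_2,x_2)\|\le N_V(t)\left(\|\vartheta_1-\vartheta_2\|_{\mathscr{C}}+\|x_1-x_2\|\right),$$ $$\|U(t,s,\vartheta_1)-U(t,s,\vartheta_2)\|\le N_U(t)\,\|\vartheta_1-\vartheta_2\|_{\mathscr{C}},$$ $$\|G(t,\vartheta_1)-G(t,\vartheta_2)\|\le L_G\,\|\vartheta_1-\vartheta_2\|_{\mathscr{C}};$$ (2) there exist constants $D_k$ ($k=1,\dots,m$) such that $\|I_k(x_1)-I_k(x_2)\|\le D_k\|x_1-x_2\|$ for all $x_1,x_2\in X$ and $k=1,\dots,m$; (3) there exist $P,J,N_k>0$ ($k=1,\dots,m$) such that $\|V(t,\vartheta,x)-\widehat V(t,\vartheta,x)\|\le P$ for all $t\in I$, $\vartheta\in\mathscr{C}$, $x\in X$; $\|\varsigma(t)-\widehat\varsigma(t)\|\le J$ for all $t\in[-r,0]$; and $\|I_k(x)-\widehat I_k(x)\|\le N_k$ for all $x\in X$ and $k=1,\dots,m$. Let $w$ be the mild solution of $$w'(t)=Aw(t)+V\Big(t,w_t,\int_0^tU(t,s,w_s)\,ds\Big),\ t\in I,\ t\ne t_k,\qquad w=\varsigma\text{ on }[-r,0],\qquad \Delta w(t_k)=I_k\Big(\int_{t_k-\tau_k}^{t_k-\theta_k}G(s,w_s)\,ds\Big),\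 k=1,\dots,m,$$ and let $v$ be the mild solution of $$v'(t)=Av(t)+\widehat V\Big(t,v_t,\int_0^tU(t,s,v_s)\,ds\Big),\ t\in I,\ t\ne t_k,\qquad v=\widehat\varsigma\text{ on }[-r,0],\qquad \Delta v(t_k)=\widehat I_k\Big(\int_{t_k-\tau_k}^{t_k-\theta_k}G(s,v_s)\,ds\Big),\ k=1,\dots,m.$$ Then $$\|w-v\|_\Sigma\le\Big(MJ+bMP+\sum_{k=1}^mMN_k\Big)\prod_{k=1}^mC_k\ \exp\left(\int_{t_m}^bMN_V(s)\Big[1+\int_0^sN_U(\sigma)d\sigma\Big]ds\right),$$ where, for $k=1,\dots,m$, $$C_k=\exp\left(\int_{t_{k-1}}^{t_k}M N_V(s)\Big[1+\int_0^sN_U(\sigma)d\sigma\Big]ds\right)+M L_G D_k\int_{t_k-\tau_k}^{t_k-\theta_k}\exp\left(\int_{t_{k-1}}^{s}M N_V(\sigma)\Big[1+\int_0^\sigma N_U(\xi)d\xi\Big]d\sigma\right)ds .$$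
   Context: Let $(X,\|\cdot\|)$ be a Banach space, $b>0$, $0<r<\infty$, $I=[0,b]$, $\mathbb{R}_+=[0,\infty)$. Let $\mathscr{C}=C([-r,0],X)$ be the Banach space of continuous functions $[-r,0]\to X$ with the supremum norm $\|\cdot\|_{\mathscr{C}}$. Let $A:D(A)\subseteq X\to X$ be the infinitesimal generator of a strongly continuous semigroup $\{T(t)\}_{t\ge0}$ of bounded linear operators on $X$, and let $M\ge1$ be a constant with $\|T(t)\|\le M$ for all $t\ge0$. Let $0=t_0<t_1<\cdots<t_m<t_{m+1}=b$ and $0\le\theta_k\le\tau_k\le t_k-t_{k-1}$ for $k=1,\dots,m$. Let $\varsigma,\widehat\varsigma\in\mathscr{C}$, let $V,\widehat V:I\times\mathscr{C}\times X\to X$, $U:I\times I\times\mathscr{C}\to X$ and $G:I\times\mathscr{C}\to X$ be given functions, let $I_k\in C(X,X)$ ($k=1,\dots,m$) be bounded functions, and let $\widehat I_k:X\to X$ ($k=1,\dots,m$) be given functions. For any continuous function $w$ defined on $[-r,b]\setminus\{t_1,\dots,t_m\}$ and $t\in[0,b]$, $w_t$ denotes the element of $\mathscr{C}$ defined by $w_t(\theta)=w(t+\theta)$, $\theta\in[-r,0]$. Also $w(t_k^{\pm})=\lim_{\epsilon\to0^{\pm}}w(t_k+\epsilon)$ and $\Delta w(t_k)=w(t_k^+)-w(t_k^-)$. Solutions are considered among functions $w:[-r,b]\to X$ equal to the given initial function on $[-r,0]$, continuous on $[0,t_1]$ and on each $(t_k,t_{k+1}]$ ($k=1,\dots,m$),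 for which $w(t_k^-)$ and $w(t_k^+)$ exist with $w(t_k^-)=w(t_k)$; for such functions and their differences, $\|w\|_\Sigma=\max_{0\le k\le m}\sup\{\|w(t)\|:t\in[t_k,t_{k+1}]\}$. A mild solution of the first problem is a function $w:[-r,b]\to X$ with $w=\varsigma$ on $[-r,0]$ and, for all $t\in I$, $$w(t)=T(t)\varsigma(0)+\int_0^tT(t-s)V\Big(s,w_s,\int_0^sU(s,\sigma,w_\sigma)d\sigma\Big)ds+\sum_{0<t_k<t}T(t-t_k)I_k\Big(\int_{t_k-\tau_k}^{t_k-\theta_k}G(s,w_s)ds\Big);$$ a mild solution of the second problem is defined in the same way with $\varsigma,V,I_k$ replaced by $\widehat\varsigma,\widehat V,\widehat I_k$.
   Formalization: The Lipschitz bound on U uses N_U(s) (second argument) instead of the printed N_U(t), with which the claim is false; the space 𝒞 is replaced by any space of bounded functions on [-r,0] containing it, since w_t is not in 𝒞 when w jumps. *)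

theory Defs
  imports "HOL-Analysis.Analysis"
begin

text \<open>
  The space \<open>C([-r,0], X)\<close> is represented by extensional functions (value \<open>undefined\<close> outside
  \<open>[-r,0]\<close>), so that its elements correspond one-to-one to functions defined on \<open>[-r,0]\<close> only.
\<close>

definition cspace :: "real \<Rightarrow> (real \<Rightarrow> 'a::real_normed_vector) set" where
  "cspace r = {\<phi> \<in> extensional {-r..0}. continuous_on {-r..0} \<phi>}"

definition snorm :: "real \<Rightarrow> (real \<Rightarrow> 'a::real_normed_vector) \<Rightarrow> real" where
  "snorm r \<phi> = (SUP \<theta>\<in>{-r..0}. norm (\<phi> \<theta>))"

definition seg :: "real \<Rightarrow> (real \<Rightarrow> 'a) \<Rightarrow> real \<Rightarrow> (real \<Rightarrow> 'a)" where
  "seg r w t = restrict (\<lambda>\<theta>. w (t + \<theta>)) {-r..0}"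

text \<open>
  If \<open>w\<close> jumps at \<open>t\<^sub>k\<close>, the segment \<open>w\<^sub>t\<close> is discontinuous whenever \<open>t - r \<le> t\<^sub>k < t\<close>, so the
  requirement that all segments lie in \<open>C([-r,0], X)\<close> would exclude every nonzero jump.  Hence the
  functionals live on a phase space \<open>Ph\<close> that contains \<open>C([-r,0], X)\<close> and consists of bounded
  functions; \<open>Ph = cspace r\<close> is the literal reading, and the piecewise continuous functions
  on \<open>[-r,0]\<close> are another instance.
\<close>

definition phase_space :: "real \<Rightarrow> (real \<Rightarrow> 'a::real_normed_vector) set \<Rightarrow> bool" where
  "phase_space r Ph \<longleftrightarrow>
     cspace r \<subseteq> Ph \<and> (\<forall>\<phi>\<in>Ph. \<phi> \<in> extensional {-r..0} \<and> bounded (\<phi> ` {-r..0}))"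

definition C0_semigroup :: "(real \<Rightarrow> 'a::real_normed_vector \<Rightarrow>\<^sub>L 'a) \<Rightarrow> bool" where
  "C0_semigroup T \<longleftrightarrow>
     T 0 = id_blinfun \<and>
     (\<forall>s\<ge>0. \<forall>t\<ge>0. T (s + t) = T s o\<^sub>L T t) \<and>
     (\<forall>x. ((\<lambda>t. T t x) \<longlongrightarrow> x) (at_right 0))"

definition infinitesimal_generator ::
  "(real \<Rightarrow> 'a::real_normed_vector \<Rightarrow>\<^sub>L 'a) \<Rightarrow> 'a set \<Rightarrow> ('a \<Rightarrow> 'a) \<Rightarrow> bool" where
  "infinitesimal_generator T D A \<longleftrightarrow>
     D = {x. \<exists>y. ((\<lambda>h. (T h x - x) /\<^sub>R h) \<longlongrightarrow> y) (at_right 0)} \<and>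
     (\<forall>x\<in>D. ((\<lambda>h. (T h x - x) /\<^sub>R h) \<longlongrightarrow> A x) (at_right 0))"

text \<open>
  The class of functions in which solutions are sought; \<open>t\<close> is the sequence of impulse times
  \<open>0 = t 0 < t 1 < \<dots> < t m < t (m + 1) = b\<close>.  Values of \<open>w\<close> outside \<open>[-r,b]\<close> are irrelevant.
\<close>

definition admissible ::
  "real \<Rightarrow> nat \<Rightarrow> (nat \<Rightarrow> real) \<Rightarrow> (real \<Rightarrow> 'a::real_normed_vector) \<Rightarrow> (real \<Rightarrow> 'a) \<Rightarrow> bool" where
  "admissible r m t \<phi> w \<longleftrightarrow>
     (\<forall>\<theta>\<in>{-r..0}. w \<theta> = \<phi> \<theta>) \<and>
     continuous_on {0..t 1} w \<and>
     (\<forall>k\<in>{1..m}. continuous_on {t k<..t (Suc k)} w \<and>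
        (w \<longlongrightarrow> w (t k)) (at_left (t k)) \<and>
        (\<exists>l. (w \<longlongrightarrow> l) (at_right (t k))))"

text \<open>
  Mild solutions.  No regularity in time is assumed of the data, so the existence of the integrals
  in the defining equation is part of being a mild solution.  The Henstock-Kurzweil integral is
  used because it is available for an arbitrary Banach space and extends the Bochner integral.
\<close>

definition mild_solution ::
  "real \<Rightarrow> real \<Rightarrow> nat \<Rightarrow> (nat \<Rightarrow> real) \<Rightarrow> (nat \<Rightarrow> real) \<Rightarrow> (nat \<Rightarrow> real) \<Rightarrow>
   (real \<Rightarrow> 'a) set \<Rightarrow> (real \<Rightarrow> 'a \<Rightarrow>\<^sub>L 'a) \<Rightarrow>
   (real \<Rightarrow> (real \<Rightarrow> 'a) \<Rightarrow> 'a \<Rightarrow> 'a) \<Rightarrow> (real \<Rightarrow> real \<Rightarrow> (real \<Rightarrow> 'a) \<Rightarrow> 'a) \<Rightarrow>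
   (real \<Rightarrow> (real \<Rightarrow> 'a) \<Rightarrow> 'a) \<Rightarrow> (nat \<Rightarrow> 'a \<Rightarrow> 'a) \<Rightarrow>
   (real \<Rightarrow> 'a) \<Rightarrow> (real \<Rightarrow> 'a::banach) \<Rightarrow> bool" where
  "mild_solution r b m t \<theta> \<tau> Ph T V U G Imp \<phi> w \<longleftrightarrow>
     admissible r m t \<phi> w \<and>
     (\<forall>s\<in>{0..b}. seg r w s \<in> Ph) \<and>
     (\<forall>s\<in>{0..b}. (\<lambda>\<sigma>. U s \<sigma> (seg r w \<sigma>)) integrable_on {0..s}) \<and>
     (\<forall>k\<in>{1..m}. (\<lambda>s. G s (seg r w s)) integrable_on {t k - \<tau> k..t k - \<theta> k}) \<and>
     (\<forall>x\<in>{0..b}.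
        (\<lambda>s. T (x - s) (V s (seg r w s) (integral {0..s} (\<lambda>\<sigma>. U s \<sigma> (seg r w \<sigma>)))))
          integrable_on {0..x} \<and>
        w x = T x (\<phi> 0)
            + integral {0..x}
                (\<lambda>s. T (x - s) (V s (seg r w s) (integral {0..s} (\<lambda>\<sigma>. U s \<sigma> (seg r w \<sigma>)))))
            + (\<Sum>k | k \<in> {1..m} \<and> 0 < t k \<and> t k < x.
                 T (x - t k) (Imp k (integral {t k - \<tau> k..t k - \<theta> k} (\<lambda>s. G s (seg r w s))))))"

definition Sigma_norm ::
  "nat \<Rightarrow> (nat \<Rightarrow> real) \<Rightarrow> (real \<Rightarrow> 'a::real_normed_vector) \<Rightarrow> real" where
  "Sigma_norm m t w = Max ((\<lambda>k. SUP x\<in>{t k..t (Suc k)}. norm (w x)) ` {0..m})"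

definition growth :: "real \<Rightarrow> (real \<Rightarrow> real) \<Rightarrow> (real \<Rightarrow> real) \<Rightarrow> real \<Rightarrow> real" where
  "growth M NV NU s = M * NV s * (1 + integral {0..s} NU)"

definition Cfac ::
  "real \<Rightarrow> (real \<Rightarrow> real) \<Rightarrow> (real \<Rightarrow> real) \<Rightarrow> real \<Rightarrow> (nat \<Rightarrow> real) \<Rightarrow>
   (nat \<Rightarrow> real) \<Rightarrow> (nat \<Rightarrow> real) \<Rightarrow> (nat \<Rightarrow> real) \<Rightarrow> nat \<Rightarrow> real" where
  "Cfac M NV NU LG Dk t \<theta> \<tau> k =
     exp (integral {t (k - 1)..t k} (growth M NV NU))
     + M * LG * Dk k *
       integral {t k - \<tau> k..t k - \<theta> k} (\<lambda>s. exp (integral {t (k - 1)..s} (growth M NV NU)))"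

end

theory Submission
  imports Defs
begin

text \<open>
  Let \<open>\<rho> x\<close> be the supremum of \<open>norm (w - v)\<close> over \<open>[-r,x]\<close>.  It bounds the distance of all segments
  up to time \<open>x\<close> and is monotone, so the distance of the inner integrals of \<open>U\<close> at time \<open>s\<close> is at
  most \<open>\<rho> s\<close> times the integral of \<open>NU\<close>.  Subtracting the two mild solution formulas then gives an
  impulsive integral inequality for \<open>\<rho>\<close> with kernel \<open>growth M NV NU\<close>.  On each interval between
  impulses Gronwall's lemma applies; as the window of the \<open>k\<close>-th impulse lies in the preceding
  interval, passing \<open>t k\<close> multiplies the bound by the factor \<open>C\<^sub>k\<close>.
\<close>

section \<open>Gronwall inequalities for functions that need not be continuous\<close>

text \<open>The second mean value theorem gives a \<open>has_integral\<close> statement for the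
  product, hence its integrability. The supremum of \<open>norm (w - v)\<close> over
  \<open>{-r..x}\<close> is monotone in \<open>x\<close> but may jump at the impulse times; this
  lemma allows it to be integrated against a continuous kernel.\<close>

lemma integrable_continuous_mult_mono_on:
  fixes f g :: "real \<Rightarrow> real"
  assumes "a \<le> b" "continuous_on {a..b} g" "mono_on {a..b} f"
  shows "(\<lambda>s. g s * f s) integrable_on {a..b}"
proof -
  have g: "g integrable_on {a..b}"
    by (rule integrable_continuous_real) fact
  obtain c where "((\<lambda>x. f x * g x) has_integral
      (f a * integral {a..c} g + f b * integral {c..b} g)) {a..b}"
    by (rule second_mean_value_theorem_full[OF g assms(1), of f])
      (use assms(3) in \<open>auto simp: mono_on_def\<close>)
  then show ?thesis
    by (auto simp: mult.commute integrable_on_def)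
qed

text \<open>
  Only integrability of \<open>g * f\<close> is assumed: the classical argument is applied to the continuous
  right-hand side rather than to \<open>f\<close>.
\<close>

lemma gronwall_integral:
  fixes f g :: "real \<Rightarrow> real"
  assumes g: "continuous_on {a..b} g" "\<And>s. s \<in> {a..b} \<Longrightarrow> 0 \<le> g s"
    and gf: "(\<lambda>s. g s * f s) integrable_on {a..b}"
    and le: "\<And>x. x \<in> {a..b} \<Longrightarrow> f x \<le> B + integral {a..x} (\<lambda>s. g s * f s)"
    and x: "x \<in> {a..b}"
  shows "B + integral {a..x} (\<lambda>s. g s * f s) \<le> B * exp (integral {a..x} g)"
proof -
  define F where "F x = B + integral {a..x} (\<lambda>s. g s * f s)" for x
  \<comment> \<open>The function \<open>F\<close> is continuous but possibly not differentiable.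
    Integrating once more gives a majorant \<open>H\<close> with \<open>f \<le> F \<le> H\<close> on
    the interval, whose derivative \<open>g * F\<close> exists because \<open>g * F\<close> is
    continuous.\<close>
  define H where "H x = B + integral {a..x} (\<lambda>s. g s * F s)" for x
  define E where "E x = exp (- integral {a..x} g)" for x
  have contF: "continuous_on {a..b} F"
    unfolding F_def using gf by (intro continuous_intros indefinite_integral_continuous_1)
  have contgF: "continuous_on {a..b} (\<lambda>s. g s * F s)"
    using contF g by (intro continuous_intros)
  have FH: "F y \<le> H y" if "y \<in> {a..b}" for y
    unfolding F_def H_def
  proof (intro add_left_mono integral_le)
    show "(\<lambda>s. g s * f s) integrable_on {a..y}"
      using gf that by (auto elim: integrable_subinterval_real)
    have "(\<lambda>s. g s * F s) integrable_on {a..y}"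
      using that by (intro integrable_continuous_real continuous_on_subset[OF contgF]) auto
    then show "(\<lambda>s. g s * (B + integral {a..s} (\<lambda>s. g s * f s))) integrable_on {a..y}"
      by (simp add: F_def)
    show "g s * f s \<le> g s * (B + integral {a..s} (\<lambda>s. g s * f s))" if "s \<in> {a..y}" for s
      using that \<open>y \<in> {a..b}\<close> by (intro mult_left_mono le g) auto
  qed
  have dH: "(H has_real_derivative g y * F y) (at y within {a..b})" if "y \<in> {a..b}" for y
    unfolding H_def using integral_has_real_derivative[OF contgF that]
    by (auto intro!: derivative_eq_intros)
  have dE: "(E has_real_derivative - (E y * g y)) (at y within {a..b})" if "y \<in> {a..b}" for y
    unfolding E_def using integral_has_real_derivative[OF g(1) that]
    by (auto intro!: derivative_eq_intros)
  \<comment> \<open>With the integrating factor \<open>E\<close> the derivative of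
    \<open>H * E\<close> is \<open>g * E * (F - H)\<close>, which is nonpositive by
    \<open>FH\<close>. At \<open>a\<close> both integrals vanish, so the product starts at
    \<open>B\<close>.\<close>
  have "H x * E x \<le> H a * E a"
  proof (rule DERIV_nonpos_imp_decreasing_open[where f = "\<lambda>y. H y * E y"])
    show "a \<le> x" using x by simp
    have "continuous_on {a..b} (\<lambda>y. H y * E y)"
      using dH dE by (intro continuous_intros DERIV_continuous_on) auto
    then show "continuous_on {a..x} (\<lambda>y. H y * E y)"
      using x by (elim continuous_on_subset) auto
    fix y assume y: "a < y" "y < x"
    then have mem: "y \<in> {a..b}" and "at y within {a..b} = at y"
      using x at_within_Icc_at[of a y b] by auto
    then have "DERIV (\<lambda>y. H y * E y) y :> g y * F y * E y + - (E y * g y) * H y"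
      using DERIV_mult[OF dH dE, of y] mem by simp
    moreover have "g y * F y * E y + - (E y * g y) * H y \<le> 0"
      using mult_left_mono[OF FH[OF mem], of "g y * E y"] g(2)[OF mem]
      by (simp add: E_def algebra_simps)
    ultimately show "\<exists>d. DERIV (\<lambda>y. H y * E y) y :> d \<and> d \<le> 0" by blast
  qed
  then have "H x * E x \<le> B" by (simp add: H_def E_def)
  then have "H x \<le> B * exp (integral {a..x} g)"
    by (simp add: E_def exp_minus field_simps)
  then show ?thesis using FH[OF x] by (simp add: F_def)
qed

text \<open>Induction over the impulses. On \<open>{t k..t (Suc k)}\<close> at most the first
  \<open>k\<close> impulse terms are active, and they do not depend on \<open>x\<close>, so the
  ordinary inequality applies there. The window \<open>{p k..q k}\<close> of an impulse lies in the
  interval before \<open>t k\<close>, where \<open>f\<close> has already been bounded; integrating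
  that bound over the window gives the second summand of the factor.\<close>

lemma gronwall_impulsive:
  fixes f g :: "real \<Rightarrow> real" and t p q c :: "nat \<Rightarrow> real"
  assumes t: "t 0 = 0" "\<And>k. k \<le> m \<Longrightarrow> t k \<le> t (Suc k)"
    and g: "continuous_on {0..t (Suc m)} g" "\<And>s. s \<in> {0..t (Suc m)} \<Longrightarrow> 0 \<le> g s"
    and gf: "(\<lambda>s. g s * f s) integrable_on {0..t (Suc m)}"
    and f: "f integrable_on {0..t (Suc m)}" "\<And>s. s \<in> {0..t (Suc m)} \<Longrightarrow> 0 \<le> f s"
    and c: "\<And>k. k \<in> {1..m} \<Longrightarrow> 0 \<le> c k"
    and pq: "\<And>k. k \<in> {1..m} \<Longrightarrow> t (k - 1) \<le> p k \<and> q k \<le> t k"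
    and le: "\<And>x. x \<in> {0..t (Suc m)} \<Longrightarrow> f x \<le> K + integral {0..x} (\<lambda>s. g s * f s)
               + (\<Sum>k | k \<in> {1..m} \<and> t k < x. c k * integral {p k..q k} f)"
    and k: "k \<le> m" and x: "x \<in> {t k..t (Suc k)}"
  shows "f x \<le> K * (\<Prod>j=1..k. exp (integral {t (j - 1)..t j} g)
             + c j * integral {p j..q j} (\<lambda>s. exp (integral {t (j - 1)..s} g)))
           * exp (integral {t k..x} g)"
proof -
  define S where "S k = (\<Sum>j=1..k. c j * integral {p j..q j} f)" for k
  \<comment> \<open>The impulse sum is frozen at its first \<open>k\<close> terms, so that
    \<open>z k\<close> varies only through its integral. Going from \<open>z k\<close> to
    \<open>z (Suc k)\<close> adds exactly one impulse term.\<close>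
  define z where "z k x = K + integral {0..x} (\<lambda>s. g s * f s) + S k" for k x
  define C where "C j = exp (integral {t (j - 1)..t j} g)
             + c j * integral {p j..q j} (\<lambda>s. exp (integral {t (j - 1)..s} g))" for j
  define B where "B k = K * (\<Prod>j=1..k. C j)" for k
  have t_mono: "t i \<le> t j" if "i \<le> j" "j \<le> Suc m" for i j
    using that by (induction rule: dec_induct) (auto intro: order_trans t(2))
  have t_range: "0 \<le> t j" "t j \<le> t (Suc m)" if "j \<le> Suc m" for j
    using t_mono[of 0 j] t_mono[of j "Suc m"] that t(1) by auto
  have pq_range: "0 \<le> p j" "q j \<le> t (Suc m)" if "j \<in> {1..m}" for j
  proof -
    have "j - 1 \<le> Suc m" "j \<le> Suc m" using that by auto
    then show "0 \<le> p j" "q j \<le> t (Suc m)"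
      using pq[OF that] t_range(1)[of "j - 1"] t_range(2)[of j] by linarith+
  qed
  have summand_nonneg: "0 \<le> c j * integral {p j..q j} f" if "j \<in> {1..m}" for j
  proof -
    have "0 \<le> integral {p j..q j} f"
      using pq_range[OF that] f
      by (intro integral_nonneg integrable_subinterval_real[OF f(1)]) auto
    then show ?thesis using c[OF that] by simp
  qed
  have f_le_z: "f x \<le> z k x" if "k \<le> m" "x \<in> {t k..t (Suc k)}" for k x
  proof -
    have "x \<in> {0..t (Suc m)}" using that t_range[of k] t_range[of "Suc k"] by auto
    moreover have "(\<Sum>j | j \<in> {1..m} \<and> t j < x. c j * integral {p j..q j} f) \<le> S k"
      unfolding S_def
    \<comment> \<open>From \<open>t j < x\<close> and \<open>x \<le> t (Suc k)\<close> it follows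
      that \<open>j \<le> k\<close>. The inclusion is proper at \<open>x = t k\<close>, where the
      strict inequality leaves out the \<open>k\<close>-th impulse, so the nonnegativity of the
      terms enters here.\<close>
    proof (rule sum_mono2)
      show "{j. j \<in> {1..m} \<and> t j < x} \<subseteq> {1..k}"
      proof safe
        fix j assume "j \<in> {1..m}" "t j < x"
        then show "j \<in> {1..k}"
          using that t_mono[of "Suc k" j] by (cases "j \<le> k") auto
      qed
    qed (use summand_nonneg that in auto)
    ultimately show ?thesis using le[of x] by (simp add: z_def)
  qed
  have z_split: "z k x = z k (t k) + integral {t k..x} (\<lambda>s. g s * f s)"
    if "k \<le> m" "x \<in> {t k..t (Suc k)}" for k x
  proof -
    have "(\<lambda>s. g s * f s) integrable_on {0..x}"
      using that t_range[of "Suc k"] by (intro integrable_subinterval_real[OF gf]) auto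
    then show ?thesis
      using Henstock_Kurzweil_Integration.integral_combine[of 0 "t k" x "\<lambda>s. g s * f s"]
        that t_range[of k] by (simp add: z_def)
  qed
  have gronwall: "z k x \<le> B k * exp (integral {t k..x} g)"
    if k: "k \<le> m" and x: "x \<in> {t k..t (Suc k)}" and start: "z k (t k) \<le> B k" for k x
  proof -
    have sub: "{t k..t (Suc k)} \<subseteq> {0..t (Suc m)}"
      using t_range[of k] t_range[of "Suc k"] k by auto
    have "z k (t k) + integral {t k..x} (\<lambda>s. g s * f s) \<le> z k (t k) * exp (integral {t k..x} g)"
    proof (rule gronwall_integral[OF _ _ _ _ x])
      show "continuous_on {t k..t (Suc k)} g" using g(1) sub by (rule continuous_on_subset)
      show "(\<lambda>s. g s * f s) integrable_on {t k..t (Suc k)}"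
        using gf sub by (rule integrable_subinterval_real)
      show "0 \<le> g s" if "s \<in> {t k..t (Suc k)}" for s
        using that sub by (intro g(2)) auto
      show "f y \<le> z k (t k) + integral {t k..y} (\<lambda>s. g s * f s)" if "y \<in> {t k..t (Suc k)}" for y
        using f_le_z[OF k that] z_split[OF k that] by simp
    qed
    also have "\<dots> \<le> B k * exp (integral {t k..x} g)"
      using start by simp
    finally show ?thesis using z_split[OF k x] by simp
  qed
  have start: "z k (t k) \<le> B k" if "k \<le> m" for k
    using that
  proof (induction k)
    case 0
    then show ?case by (simp add: z_def B_def S_def t(1))
  next
    case (Suc k)
    then have k: "k \<le> m" "Suc k \<in> {1..m}" and IH: "z k (t k) \<le> B k" by auto
    have sub: "{p (Suc k)..q (Suc k)} \<subseteq> {t k..t (Suc k)}"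
      using pq[OF k(2)] by auto
    have sub': "{t k..t (Suc k)} \<subseteq> {0..t (Suc m)}"
      using t_range[of k] t_range[of "Suc k"] k by auto
    have contE: "continuous_on {t k..t (Suc k)} (\<lambda>s. B k * exp (integral {t k..s} g))"
      by (intro continuous_intros indefinite_integral_continuous_1 integrable_continuous_real
          continuous_on_subset[OF g(1) sub'])
    \<comment> \<open>The induction hypothesis and Gronwall bound \<open>f\<close> on the whole
      window by \<open>B k\<close> times an exponential. The same constant \<open>B k\<close> bounds
      the growth up to \<open>t (Suc k)\<close>, so it factors out of both contributions and leaves
      \<open>C (Suc k)\<close>.\<close>
    have "integral {p (Suc k)..q (Suc k)} f
        \<le> integral {p (Suc k)..q (Suc k)} (\<lambda>s. B k * exp (integral {t k..s} g))"
    proof (rule integral_le)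
      show "f integrable_on {p (Suc k)..q (Suc k)}"
        using sub sub' by (intro integrable_subinterval_real[OF f(1)]) auto
      show "(\<lambda>s. B k * exp (integral {t k..s} g)) integrable_on {p (Suc k)..q (Suc k)}"
        by (intro integrable_continuous_real continuous_on_subset[OF contE sub])
      show "f s \<le> B k * exp (integral {t k..s} g)" if "s \<in> {p (Suc k)..q (Suc k)}" for s
        using f_le_z[OF k(1)] gronwall[OF k(1) _ IH] that sub by (meson order_trans subsetD)
    qed
    then have "c (Suc k) * integral {p (Suc k)..q (Suc k)} f
        \<le> c (Suc k) * (B k * integral {p (Suc k)..q (Suc k)} (\<lambda>s. exp (integral {t k..s} g)))"
      using c[OF k(2)] by (intro mult_left_mono) simp_all
    moreover have "z k (t (Suc k)) \<le> B k * exp (integral {t k..t (Suc k)} g)"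
      using gronwall[OF k(1) _ IH] t(2)[OF k(1)] by simp
    moreover have "z (Suc k) (t (Suc k)) = z k (t (Suc k)) + c (Suc k) * integral {p (Suc k)..q (Suc k)} f"
      by (simp add: z_def S_def)
    moreover have "B (Suc k) = B k * C (Suc k)"
      by (simp add: B_def)
    ultimately show ?case
      by (simp add: C_def algebra_simps)
  qed
  show ?thesis
    using f_le_z[OF k x] gronwall[OF k x start[OF k]] by (simp add: B_def C_def)
qed

section \<open>Boundedness and distance of segments\<close>

text \<open>A segment in the phase space is bounded, so \<open>w\<close> is bounded on each window
  \<open>{s - r..s}\<close>, and finitely many such windows cover \<open>{-r..b}\<close>. This makes
  the suprema of \<open>norm (w - v)\<close> finite, so that \<open>SUP\<close> is a true upper
  bound.\<close>

lemma bounded_image_of_segments: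
  fixes w :: "real \<Rightarrow> 'a::real_normed_vector"
  assumes "0 < r" "0 \<le> b" "phase_space r Ph" "\<And>s. s \<in> {0..b} \<Longrightarrow> seg r w s \<in> Ph"
  shows "bounded (w ` {-r..b})"
proof -
  have window: "bounded (w ` {s - r..s})" if "s \<in> {0..b}" for s
  proof -
    have "bounded (seg r w s ` {-r..0})"
      using assms(3,4) that by (auto simp: phase_space_def)
    moreover have "w ` {s - r..s} \<subseteq> seg r w s ` {-r..0}"
    proof
      fix y assume "y \<in> w ` {s - r..s}"
      then obtain x where "x \<in> {s - r..s}" "y = w x" by auto
      then show "y \<in> seg r w s ` {-r..0}"
        by (intro image_eqI[of _ _ "x - s"]) (auto simp: seg_def)
    qed
    ultimately show ?thesis by (rule bounded_subset)
  qed
  \<comment> \<open>The number \<open>n\<close> bounds how many steps of length \<open>r\<close>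
    lead from \<open>s\<close> back to \<open>0\<close>. The maximum \<open>max 0 (s - r)\<close>
    keeps the previous endpoint in \<open>{0..b}\<close>, where segments are known to lie in
    \<open>Ph\<close>; for \<open>n = 0\<close> only \<open>s = 0\<close> remains.\<close>
  have "bounded (w ` {-r..s})" if "s \<in> {0..b}" "s \<le> real n * r" for n s
    using that
  proof (induction n arbitrary: s)
    case 0
    then show ?case using window[of 0] assms(2) by simp
  next
    case (Suc n)
    have "bounded (w ` {-r..max 0 (s - r)})"
      using Suc assms(1) by (intro Suc.IH) (auto simp: algebra_simps)
    moreover have "w ` {-r..s} \<subseteq> w ` {-r..max 0 (s - r)} \<union> w ` {s - r..s}"
      unfolding image_Un[symmetric] by (rule image_mono) auto
    ultimately show ?case
      using window[OF Suc.prems(1)] by (meson bounded_Un bounded_subset)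
  qed
  moreover obtain n where "b \<le> real n * r"
    using ex_less_of_nat_mult[OF assms(1)] by (meson less_imp_le)
  ultimately show ?thesis using assms(2) by simp
qed

lemma snorm_seg_diff_le:
  assumes "0 \<le> r" "bdd_above ((\<lambda>y. norm (w y - v y)) ` {-r..b})" "s \<in> {0..b}"
  shows "snorm r (\<lambda>\<sigma>. seg r w s \<sigma> - seg r v s \<sigma>) \<le> (SUP y\<in>{-r..s}. norm (w y - v y))"
  unfolding snorm_def
proof (rule cSUP_least)
  fix \<sigma> assume "\<sigma> \<in> {-r..0}"
  moreover have "bdd_above ((\<lambda>y. norm (w y - v y)) ` {-r..s})"
    using assms(3) by (intro bdd_above_mono[OF assms(2)] image_mono) auto
  ultimately show "norm (seg r w s \<sigma> - seg r v s \<sigma>) \<le> (SUP y\<in>{-r..s}. norm (w y - v y))"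
    using assms(3) by (auto simp: seg_def intro!: cSUP_upper2[where x = "s + \<sigma>"])
qed (use assms in auto)

lemma norm_blinfun_le: "norm L \<le> M \<Longrightarrow> norm y \<le> c \<Longrightarrow> norm (blinfun_apply L y) \<le> M * c"
  by (rule order_trans[OF norm_blinfun]) (auto intro!: mult_mono intro: order_trans[OF norm_ge_zero])

theorem theorem4p3:
  fixes r b M LG P J :: real
    and m :: nat
    and t \<theta> \<tau> Dk N :: "nat \<Rightarrow> real"
    and T :: "real \<Rightarrow> 'a::banach \<Rightarrow>\<^sub>L 'a"
    and D :: "'a set"
    and A :: "'a \<Rightarrow> 'a"
    and Ph :: "(real \<Rightarrow> 'a) set"
    and V V' :: "real \<Rightarrow> (real \<Rightarrow> 'a) \<Rightarrow> 'a \<Rightarrow> 'a"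
    and U :: "real \<Rightarrow> real \<Rightarrow> (real \<Rightarrow> 'a) \<Rightarrow> 'a"
    and G :: "real \<Rightarrow> (real \<Rightarrow> 'a) \<Rightarrow> 'a"
    and Imp Imp' :: "nat \<Rightarrow> 'a \<Rightarrow> 'a"
    and \<phi> \<phi>' w v :: "real \<Rightarrow> 'a"
    and NV NU :: "real \<Rightarrow> real"
  assumes "b > 0" and "r > 0"
    and "C0_semigroup T" and "infinitesimal_generator T D A"
    and "M \<ge> 1" and "\<And>x. x \<ge> 0 \<Longrightarrow> norm (T x) \<le> M"
    and "t 0 = 0" and "\<And>k. k \<le> m \<Longrightarrow> t k < t (Suc k)" and "t (Suc m) = b"
    and "\<And>k. k \<in> {1..m} \<Longrightarrow> 0 \<le> \<theta> k \<and> \<theta> k \<le> \<tau> k \<and> \<tau> k \<le> t k - t (k - 1)"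
    and "phase_space r Ph"
    and "\<phi> \<in> cspace r" and "\<phi>' \<in> cspace r"
    and "\<And>k. k \<in> {1..m} \<Longrightarrow> continuous_on UNIV (Imp k) \<and> bounded (range (Imp k))"
    and "continuous_on {0..b} NV" and "\<And>x. x \<in> {0..b} \<Longrightarrow> NV x \<ge> 0"
    and "continuous_on {0..b} NU" and "\<And>x. x \<in> {0..b} \<Longrightarrow> NU x \<ge> 0"
    and "LG > 0"
    and V_Lipschitz: "\<And>x \<psi>1 \<psi>2 y1 y2. x \<in> {0..b} \<Longrightarrow> \<psi>1 \<in> Ph \<Longrightarrow> \<psi>2 \<in> Ph \<Longrightarrow>
          norm (V x \<psi>1 y1 - V x \<psi>2 y2)
            \<le> NV x * (snorm r (\<lambda>\<sigma>. \<psi>1 \<sigma> - \<psi>2 \<sigma>) + norm (y1 - y2))"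
    and U_Lipschitz: "\<And>x s \<psi>1 \<psi>2. x \<in> {0..b} \<Longrightarrow> s \<in> {0..b} \<Longrightarrow> \<psi>1 \<in> Ph \<Longrightarrow> \<psi>2 \<in> Ph \<Longrightarrow>
          norm (U x s \<psi>1 - U x s \<psi>2) \<le> NU s * snorm r (\<lambda>\<sigma>. \<psi>1 \<sigma> - \<psi>2 \<sigma>)"
    and G_Lipschitz: "\<And>x \<psi>1 \<psi>2. x \<in> {0..b} \<Longrightarrow> \<psi>1 \<in> Ph \<Longrightarrow> \<psi>2 \<in> Ph \<Longrightarrow>
          norm (G x \<psi>1 - G x \<psi>2) \<le> LG * snorm r (\<lambda>\<sigma>. \<psi>1 \<sigma> - \<psi>2 \<sigma>)"
    and "\<And>k. k \<in> {1..m} \<Longrightarrow> Dk k \<ge> 0"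
    and Imp_Lipschitz: "\<And>k y1 y2. k \<in> {1..m} \<Longrightarrow>
          norm (Imp k y1 - Imp k y2) \<le> Dk k * norm (y1 - y2)"
    and "P > 0" and "J > 0" and "\<And>k. k \<in> {1..m} \<Longrightarrow> N k > 0"
    and V_close: "\<And>x \<psi> y. x \<in> {0..b} \<Longrightarrow> \<psi> \<in> Ph \<Longrightarrow> norm (V x \<psi> y - V' x \<psi> y) \<le> P"
    and \<phi>_close: "\<And>x. x \<in> {-r..0} \<Longrightarrow> norm (\<phi> x - \<phi>' x) \<le> J"
    and Imp_close: "\<And>k y. k \<in> {1..m} \<Longrightarrow> norm (Imp k y - Imp' k y) \<le> N k"
    and "mild_solution r b m t \<theta> \<tau> Ph T V U G Imp \<phi> w"
    and "mild_solution r b m t \<theta> \<tau> Ph T V' U G Imp' \<phi>' v"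
  shows "Sigma_norm m t (\<lambda>x. w x - v x)
           \<le> (M * J + b * M * P + (\<Sum>k=1..m. M * N k))
             * (\<Prod>k=1..m. Cfac M NV NU LG Dk t \<theta> \<tau> k)
             * exp (integral {t m..b} (growth M NV NU))"
proof -
  note T_le = assms(6) and t0 = assms(7) and t_less = assms(8) and t_last = assms(9)
    and window = assms(10) and NV = assms(15,16) and NU = assms(17,18) and Dk = assms(23)
    and N = assms(27)
  note sol_w = assms(31)[unfolded mild_solution_def]
    and sol_v = assms(32)[unfolded mild_solution_def]
  define u where "u x = norm (w x - v x)" for x
  define \<rho> where "\<rho> x = (SUP y\<in>{-r..x}. u y)" for x
  define g where "g = growth M NV NU"
  define K where "K = M * J + b * M * P + (\<Sum>k=1..m. M * N k)"
  define p where "p k = t k - \<tau> k" for k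
  define q where "q k = t k - \<theta> k" for k
  define yw where "yw s = integral {0..s} (\<lambda>\<sigma>. U s \<sigma> (seg r w \<sigma>))" for s
  define yv where "yv s = integral {0..s} (\<lambda>\<sigma>. U s \<sigma> (seg r v \<sigma>))" for s
  define gw where "gw k = integral {p k..q k} (\<lambda>s. G s (seg r w s))" for k
  define gv where "gv k = integral {p k..q k} (\<lambda>s. G s (seg r v s))" for k
  have Ph: "seg r w s \<in> Ph" "seg r v s \<in> Ph" if "s \<in> {0..b}" for s
    using sol_w sol_v that by auto

  \<comment> \<open>The running supremum and the kernel\<close>
  have bdd_b: "bdd_above (u ` {-r..b})"
  proof -
    have "bounded (w ` {-r..b})" "bounded (v ` {-r..b})"
      using bounded_image_of_segments[OF \<open>r > 0\<close> _ \<open>phase_space r Ph\<close>] Ph \<open>b > 0\<close> by auto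
    then have "bounded ((\<lambda>x. w x - v x) ` {-r..b})"
      by (rule bounded_minus_comp)
    then have "bounded (u ` {-r..b})"
      by (simp add: u_def bounded_iff)
    then show ?thesis
      by (rule bounded_imp_bdd_above)
  qed
  have bdd: "bdd_above (u ` {-r..x})" if "x \<le> b" for x
    using that by (intro bdd_above_mono[OF bdd_b] image_mono) auto
  have u_le: "u y \<le> \<rho> x" if "-r \<le> y" "y \<le> x" "x \<le> b" for x y
    unfolding \<rho>_def using that bdd[of x] by (intro cSUP_upper) auto
  have \<rho>_mono: "\<rho> x \<le> \<rho> y" if "0 \<le> x" "x \<le> y" "y \<le> b" for x y
    unfolding \<rho>_def using that bdd[of y] \<open>r > 0\<close> by (intro cSUP_subset_mono) auto
  have \<rho>_mono_on: "mono_on {0..x} \<rho>" if "x \<le> b" for x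
    using that by (auto intro!: mono_onI \<rho>_mono)
  have \<rho>_nonneg: "0 \<le> \<rho> x" if "x \<in> {0..b}" for x
    using u_le[of 0 x] that \<open>r > 0\<close> by (auto simp: u_def intro: order_trans[OF norm_ge_zero])
  have seg_le: "snorm r (\<lambda>\<sigma>. seg r w s \<sigma> - seg r v s \<sigma>) \<le> \<rho> s" if "s \<in> {0..b}" for s
    using snorm_seg_diff_le[of r w v b s] bdd_b that \<open>r > 0\<close> by (simp add: u_def[abs_def] \<rho>_def)
  have NU_int: "NU integrable_on {0..s}" if "s \<in> {0..b}" for s
    using that by (intro integrable_continuous_real continuous_on_subset[OF NU(1)]) auto
  have g_cont: "continuous_on {0..b} g"
    unfolding g_def growth_def using NV(1) NU_int[of b] \<open>b > 0\<close>
    by (intro continuous_intros indefinite_integral_continuous_1) auto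
  have g_nonneg: "0 \<le> g s" if "s \<in> {0..b}" for s
    unfolding g_def growth_def
    using that NV(2)[OF that] \<open>M \<ge> 1\<close> NU
    by (intro mult_nonneg_nonneg add_nonneg_nonneg integral_nonneg NU_int) auto
  have g\<rho>: "(\<lambda>s. g s * \<rho> s) integrable_on {0..x}" if "x \<in> {0..b}" for x
    using that
    by (intro integrable_continuous_mult_mono_on \<rho>_mono_on continuous_on_subset[OF g_cont]) auto
  have \<rho>_int: "\<rho> integrable_on {0..b}"
    by (intro integrable_on_mono_on \<rho>_mono_on) simp

  \<comment> \<open>Impulse times and windows\<close>
  have t_mono: "t i \<le> t j" if "i \<le> j" "j \<le> Suc m" for i j
    using that by (induction rule: dec_induct) (auto intro: order_trans less_imp_le t_less)
  have t_range: "0 \<le> t k" "t k \<le> b" if "k \<le> Suc m" for k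
    using t_mono[of 0 k] t_mono[of k "Suc m"] that t0 t_last by auto
  have t_pos: "0 < t k" if "k \<in> {1..m}" for k
    using t_less[of 0] t0 t_mono[of 1 k] that by simp
  have pq: "t (k - 1) \<le> p k \<and> q k \<le> t k" if "k \<in> {1..m}" for k
    using window[OF that] by (simp add: p_def q_def)
  have pq_sub: "{p k..q k} \<subseteq> {0..b}" if "k \<in> {1..m}" for k
  proof -
    have "k - 1 \<le> Suc m" "k \<le> Suc m" using that by auto
    then have "0 \<le> p k" "q k \<le> b"
      using pq[OF that] t_range(1)[of "k - 1"] t_range(2)[of k] by linarith+
    then show ?thesis by auto
  qed

  \<comment> \<open>Differences of the data along the two solutions\<close>
  have y_le: "norm (yw s - yv s) \<le> integral {0..s} NU * \<rho> s" if s: "s \<in> {0..b}" for s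
  proof -
    have ints: "(\<lambda>\<sigma>. U s \<sigma> (seg r w \<sigma>)) integrable_on {0..s}"
        "(\<lambda>\<sigma>. U s \<sigma> (seg r v \<sigma>)) integrable_on {0..s}"
      using sol_w sol_v s by auto
    have "norm (integral {0..s} (\<lambda>\<sigma>. U s \<sigma> (seg r w \<sigma>) - U s \<sigma> (seg r v \<sigma>)))
        \<le> integral {0..s} (\<lambda>\<sigma>. NU \<sigma> * \<rho> s)"
    proof (rule Henstock_Kurzweil_Integration.integral_norm_bound_integral)
      fix \<sigma> assume "\<sigma> \<in> {0..s}"
      then have \<sigma>: "\<sigma> \<in> {0..b}" and "\<rho> \<sigma> \<le> \<rho> s" using s by (auto intro: \<rho>_mono)
      \<comment> \<open>The weight \<open>NU\<close> is taken at the integration variable, which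
        produces the factor \<open>integral {0..s} NU\<close> of the kernel. Replacing
        \<open>\<rho> \<sigma>\<close> by the larger \<open>\<rho> s\<close> makes the other factor
        constant, so no double integral of \<open>\<rho>\<close> arises.\<close>
      have "norm (U s \<sigma> (seg r w \<sigma>) - U s \<sigma> (seg r v \<sigma>))
          \<le> NU \<sigma> * snorm r (\<lambda>x. seg r w \<sigma> x - seg r v \<sigma> x)"
        by (intro U_Lipschitz s \<sigma> Ph)
      also have "\<dots> \<le> NU \<sigma> * \<rho> s"
        using seg_le[OF \<sigma>] \<open>\<rho> \<sigma> \<le> \<rho> s\<close> NU(2)[OF \<sigma>] by (intro mult_left_mono) auto
      finally show "norm (U s \<sigma> (seg r w \<sigma>) - U s \<sigma> (seg r v \<sigma>)) \<le> NU \<sigma> * \<rho> s" .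
    qed (use ints NU_int[OF s] in \<open>auto intro: integrable_diff integrable_on_mult_left\<close>)
    then show ?thesis
      using ints by (simp add: yw_def yv_def Henstock_Kurzweil_Integration.integral_diff)
  qed
  have V_le: "norm (V s (seg r w s) (yw s) - V' s (seg r v s) (yv s))
      \<le> P + NV s * (1 + integral {0..s} NU) * \<rho> s" if s: "s \<in> {0..b}" for s
  proof -
    \<comment> \<open>The comparison passes through \<open>V\<close> at the arguments of
      \<open>v\<close>: the Lipschitz bound concerns \<open>V\<close> alone, and
      \<open>V_close\<close> then exchanges \<open>V\<close> for \<open>V'\<close> at a single
      point. The impulses are compared in the same way in \<open>Imp_le\<close>.\<close>
    have "norm (V s (seg r w s) (yw s) - V s (seg r v s) (yv s))
        \<le> NV s * (snorm r (\<lambda>\<sigma>. seg r w s \<sigma> - seg r v s \<sigma>) + norm (yw s - yv s))"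
      by (intro V_Lipschitz s Ph)
    also have "\<dots> \<le> NV s * (\<rho> s + integral {0..s} NU * \<rho> s)"
      by (intro mult_left_mono add_mono seg_le y_le NV s)
    finally show ?thesis
      using V_close[OF s Ph(2)[OF s], of "yv s"]
        norm_triangle_ineq[of "V s (seg r w s) (yw s) - V s (seg r v s) (yv s)"
          "V s (seg r v s) (yv s) - V' s (seg r v s) (yv s)"]
      by (simp add: algebra_simps)
  qed
  have G_le: "norm (gw k - gv k) \<le> LG * integral {p k..q k} \<rho>" if k: "k \<in> {1..m}" for k
  proof -
    have ints: "(\<lambda>s. G s (seg r w s)) integrable_on {p k..q k}"
        "(\<lambda>s. G s (seg r v s)) integrable_on {p k..q k}"
      using sol_w sol_v k by (auto simp: p_def q_def)
    have "norm (integral {p k..q k} (\<lambda>s. G s (seg r w s) - G s (seg r v s)))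
        \<le> integral {p k..q k} (\<lambda>s. LG * \<rho> s)"
    proof (rule Henstock_Kurzweil_Integration.integral_norm_bound_integral)
      have "\<rho> integrable_on {p k..q k}"
        using \<rho>_int pq_sub[OF k] by (rule integrable_subinterval_real)
      then show "(\<lambda>s. LG * \<rho> s) integrable_on {p k..q k}"
        by (rule integrable_on_mult_right)
      fix s assume "s \<in> {p k..q k}"
      then have s: "s \<in> {0..b}" using pq_sub[OF k] by auto
      show "norm (G s (seg r w s) - G s (seg r v s)) \<le> LG * \<rho> s"
        using G_Lipschitz[OF s Ph(1)[OF s] Ph(2)[OF s]] seg_le[OF s] \<open>LG > 0\<close>
        by (meson mult_left_mono less_imp_le order_trans)
    qed (use ints in \<open>auto intro: integrable_diff\<close>)
    then show ?thesis
      using ints by (simp add: gw_def gv_def Henstock_Kurzweil_Integration.integral_diff)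
  qed
  have Imp_le: "norm (Imp k (gw k) - Imp' k (gv k)) \<le> N k + Dk k * LG * integral {p k..q k} \<rho>"
    if k: "k \<in> {1..m}" for k
    using Imp_Lipschitz[OF k, of "gw k" "gv k"] Imp_close[OF k, of "gv k"]
      mult_left_mono[OF G_le[OF k] Dk[OF k]]
      norm_triangle_ineq[of "Imp k (gw k) - Imp k (gv k)" "Imp k (gv k) - Imp' k (gv k)"]
    by (simp add: mult.assoc)

  \<comment> \<open>The impulsive integral inequality for the running supremum\<close>
  define R where "R x = K + integral {0..x} (\<lambda>s. g s * \<rho> s)
      + (\<Sum>k | k \<in> {1..m} \<and> t k < x. M * LG * Dk k * integral {p k..q k} \<rho>)" for x
  have term_nonneg: "0 \<le> M * LG * Dk k * integral {p k..q k} \<rho>" if k: "k \<in> {1..m}" for k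
  proof -
    have "0 \<le> integral {p k..q k} \<rho>"
      using pq_sub[OF k]
      by (intro integral_nonneg integrable_subinterval_real[OF \<rho>_int] \<rho>_nonneg) auto
    then show ?thesis using Dk[OF k] \<open>M \<ge> 1\<close> \<open>LG > 0\<close> by simp
  qed
  \<comment> \<open>Subtracting the solution formulas bounds only \<open>u x\<close> at a single
    time. Since \<open>R\<close> is nondecreasing, the pointwise bound at all
    \<open>y \<le> x\<close> carries over to the supremum \<open>\<rho> x\<close>.\<close>
  have R_mono: "R x \<le> R y" if "0 \<le> x" "x \<le> y" "y \<le> b" for x y
    unfolding R_def
  proof (intro add_mono order_refl)
    show "integral {0..x} (\<lambda>s. g s * \<rho> s) \<le> integral {0..y} (\<lambda>s. g s * \<rho> s)"
      using that g\<rho>[of x] g\<rho>[of y] g_nonneg \<rho>_nonneg by (intro integral_subset_le) auto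
    show "(\<Sum>k | k \<in> {1..m} \<and> t k < x. M * LG * Dk k * integral {p k..q k} \<rho>)
        \<le> (\<Sum>k | k \<in> {1..m} \<and> t k < y. M * LG * Dk k * integral {p k..q k} \<rho>)"
      using that term_nonneg by (intro sum_mono2) auto
  qed
  have u_le_R: "u x \<le> R x" if x: "x \<in> {0..b}" for x
  proof -
    define Iw where "Iw s = T (x - s) (V s (seg r w s) (yw s))" for s
    define Iv where "Iv s = T (x - s) (V' s (seg r v s) (yv s))" for s
    \<comment> \<open>Locally \<open>A\<close> is the set of impulses before \<open>x\<close>; it
      shadows the generator.\<close>
    define A where "A = {k. k \<in> {1..m} \<and> t k < x}"
    have A_eq: "{k. k \<in> {1..m} \<and> 0 < t k \<and> t k < x} = A"
      using t_pos by (auto simp: A_def)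
    have fin: "finite A" and A_sub: "A \<subseteq> {1..m}" by (auto simp: A_def)
    have ints: "Iw integrable_on {0..x}" "Iv integrable_on {0..x}"
      using sol_w sol_v x by (auto simp: Iw_def[abs_def] Iv_def[abs_def] yw_def yv_def)
    have wx: "w x = T x (\<phi> 0) + integral {0..x} Iw + (\<Sum>k\<in>A. T (x - t k) (Imp k (gw k)))"
      using sol_w x A_eq by (auto simp: Iw_def[abs_def] yw_def gw_def p_def q_def)
    have vx: "v x = T x (\<phi>' 0) + integral {0..x} Iv + (\<Sum>k\<in>A. T (x - t k) (Imp' k (gv k)))"
      using sol_v x A_eq by (auto simp: Iv_def[abs_def] yv_def gv_def p_def q_def)
    have eq: "w x - v x = T x (\<phi> 0 - \<phi>' 0) + integral {0..x} (\<lambda>s. Iw s - Iv s)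
        + (\<Sum>k\<in>A. T (x - t k) (Imp k (gw k) - Imp' k (gv k)))"
      using ints
      by (simp add: wx vx blinfun.diff_right sum_subtractf
          Henstock_Kurzweil_Integration.integral_diff)
    have 1: "norm (T x (\<phi> 0 - \<phi>' 0)) \<le> M * J"
      using x \<open>r > 0\<close> by (intro norm_blinfun_le T_le \<phi>_close) auto
    have "norm (integral {0..x} (\<lambda>s. Iw s - Iv s)) \<le> integral {0..x} (\<lambda>s. M * P + g s * \<rho> s)"
    proof (rule Henstock_Kurzweil_Integration.integral_norm_bound_integral)
      show "(\<lambda>s. Iw s - Iv s) integrable_on {0..x}" using ints by (rule integrable_diff)
      show "(\<lambda>s. M * P + g s * \<rho> s) integrable_on {0..x}"
        using g\<rho>[OF x] by (intro integrable_add) auto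
      fix s assume s: "s \<in> {0..x}"
      have "norm (Iw s - Iv s) \<le> M * (P + NV s * (1 + integral {0..s} NU) * \<rho> s)"
        unfolding Iw_def Iv_def blinfun.diff_right[symmetric]
        using s x by (intro norm_blinfun_le T_le V_le) auto
      then show "norm (Iw s - Iv s) \<le> M * P + g s * \<rho> s"
        by (simp add: g_def growth_def algebra_simps)
    qed
    also have "\<dots> = x * M * P + integral {0..x} (\<lambda>s. g s * \<rho> s)"
      using g\<rho>[OF x] x by (subst Henstock_Kurzweil_Integration.integral_add) auto
    also have "\<dots> \<le> b * M * P + integral {0..x} (\<lambda>s. g s * \<rho> s)"
      using x \<open>M \<ge> 1\<close> \<open>P > 0\<close> by (intro add_right_mono mult_right_mono) auto
    finally have 2: "norm (integral {0..x} (\<lambda>s. Iw s - Iv s))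
        \<le> b * M * P + integral {0..x} (\<lambda>s. g s * \<rho> s)" .
    have "norm (\<Sum>k\<in>A. T (x - t k) (Imp k (gw k) - Imp' k (gv k)))
        \<le> (\<Sum>k\<in>A. M * (N k + Dk k * LG * integral {p k..q k} \<rho>))"
      using A_sub by (intro sum_norm_le norm_blinfun_le T_le Imp_le) (auto simp: A_def)
    also have "\<dots> = (\<Sum>k\<in>A. M * N k) + (\<Sum>k\<in>A. M * LG * Dk k * integral {p k..q k} \<rho>)"
      by (simp add: sum.distrib[symmetric] algebra_simps)
    also have "(\<Sum>k\<in>A. M * N k) \<le> (\<Sum>k=1..m. M * N k)"
      using A_sub N \<open>M \<ge> 1\<close> by (intro sum_mono2) (auto simp: less_imp_le)
    finally have 3: "norm (\<Sum>k\<in>A. T (x - t k) (Imp k (gw k) - Imp' k (gv k)))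
        \<le> (\<Sum>k=1..m. M * N k) + (\<Sum>k\<in>A. M * LG * Dk k * integral {p k..q k} \<rho>)"
      by simp
    show ?thesis
      unfolding u_def eq R_def K_def A_def[symmetric]
      using norm_triangle_mono[OF norm_triangle_mono[OF 1 2] 3] by simp
  qed
  \<comment> \<open>On \<open>{-r..0}\<close> no solution formula is available and the difference is
    bounded by \<open>J\<close> directly. As \<open>M \<ge> 1\<close>, the constant \<open>K\<close>
    absorbs this bound, so \<open>R\<close> also covers the initial part of the supremum.\<close>
  have J_le_R: "J \<le> R 0"
  proof -
    have "J \<le> M * J" using \<open>M \<ge> 1\<close> \<open>J > 0\<close> by simp
    moreover have "0 \<le> b * M * P" using \<open>b > 0\<close> \<open>M \<ge> 1\<close> \<open>P > 0\<close> by simp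
    moreover have "0 \<le> (\<Sum>k=1..m. M * N k)"
      using \<open>M \<ge> 1\<close> N by (intro sum_nonneg) (auto simp: less_imp_le)
    moreover have "0 \<le> (\<Sum>k | k \<in> {1..m} \<and> t k < 0. M * LG * Dk k * integral {p k..q k} \<rho>)"
      using term_nonneg by (intro sum_nonneg) auto
    ultimately show ?thesis by (simp add: R_def K_def)
  qed
  have \<rho>_le: "\<rho> x \<le> R x" if x: "x \<in> {0..b}" for x
    unfolding \<rho>_def
  proof (rule cSUP_least)
    fix y assume y: "y \<in> {-r..x}"
    show "u y \<le> R x"
    proof (cases "y \<le> 0")
      case True
      then have "w y = \<phi> y" "v y = \<phi>' y"
        using sol_w sol_v y by (auto simp: admissible_def)
      then have "u y \<le> J" using \<phi>_close[of y] True y by (simp add: u_def)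
      then show ?thesis using J_le_R R_mono[of 0 x] x by simp
    next
      case False
      then show ?thesis using u_le_R[of y] R_mono[of y x] x y by simp
    qed
  qed (use x \<open>r > 0\<close> in auto)

  \<comment> \<open>Gronwall's lemma and the final estimate\<close>
  have "\<rho> b \<le> K * (\<Prod>k=1..m. exp (integral {t (k - 1)..t k} g)
             + M * LG * Dk k * integral {p k..q k} (\<lambda>s. exp (integral {t (k - 1)..s} g)))
           * exp (integral {t m..b} g)"
  \<comment> \<open>The instance has \<open>c k = M * LG * Dk k\<close> and is evaluated on the last
    interval, \<open>k = m\<close> and \<open>x = b\<close>, so that the product runs over all
    impulses and its factors are those of \<open>Cfac\<close>.\<close>
  proof (rule gronwall_impulsive[where t = t and f = \<rho>])
    show "\<rho> x \<le> K + integral {0..x} (\<lambda>s. g s * \<rho> s)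
        + (\<Sum>k | k \<in> {1..m} \<and> t k < x. M * LG * Dk k * integral {p k..q k} \<rho>)"
      if "x \<in> {0..t (Suc m)}" for x
      using \<rho>_le[of x] that t_last by (simp add: R_def)
  qed (use t0 t_less t_last g_cont g_nonneg g\<rho>[of b] \<rho>_int \<rho>_nonneg Dk pq \<open>b > 0\<close> \<open>M \<ge> 1\<close> \<open>LG > 0\<close>
      t_range[of m] in \<open>auto simp: less_imp_le\<close>)
  also have "\<dots> = K * (\<Prod>k=1..m. Cfac M NV NU LG Dk t \<theta> \<tau> k) * exp (integral {t m..b} g)"
    by (simp add: Cfac_def g_def p_def q_def)
  finally have final: "\<rho> b \<le> K * (\<Prod>k=1..m. Cfac M NV NU LG Dk t \<theta> \<tau> k) * exp (integral {t m..b} g)" .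
  \<comment> \<open>Every interval \<open>{t k..t (Suc k)}\<close> lies in \<open>{-r..b}\<close>,
    over which \<open>\<rho> b\<close> is the supremum, so this one value bounds each of the
    finitely many suprema.\<close>
  have "Sigma_norm m t (\<lambda>x. w x - v x) \<le> \<rho> b"
    unfolding Sigma_norm_def u_def[symmetric]
  proof (rule Max.boundedI)
    fix a assume "a \<in> (\<lambda>k. SUP x\<in>{t k..t (Suc k)}. u x) ` {0..m}"
    then obtain k where k: "k \<le> m" and a: "a = (SUP x\<in>{t k..t (Suc k)}. u x)" by auto
    show "a \<le> \<rho> b"
      unfolding a using k t_range[of k] t_range[of "Suc k"] \<open>r > 0\<close> less_imp_le[OF t_less[OF k]]
      by (intro cSUP_least u_le) auto
  qed auto
  then show ?thesis using final by (simp add: K_def g_def)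
qed

end
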